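(* Let $X$ be a chain and let $\alpha,\beta\in\mathcal{OP}(X)$. Then $\alpha\,\mathcal{H}\,\beta$ in $\mathcal{OP}(X)$ if and only if $\mathrm{Im}(\alpha)=\mathrm{Im}(\beta)$, $\ker(\alpha)=\ker(\beta)$ and the canonical bijection $\phi:\mathrm{Im}(\alpha)\to\mathrm{Im}(\beta)$ is bicompletable in $\mathcal{OP}(X)$.
   Context: $X$ is a chain (totally ordered set), finite or infinite. Maps are written on the right and composed from left to right: $x(\alpha\beta)=(x\alpha)\beta$. A full transformation $\alpha:X\to X$ is orientation-preserving if it is the empty transformation (only when $X=\emptyset$) or there exists a non-empty subset $Y$ of $X$ such that: (OP1) $\alpha$ is order-preserving (i.e. $x\le y$ implies $x\alpha\le y\alpha$) both on $Y$ and on $X\setminus Y$; (OP2) for all $a\in Y$ and $b\in X\setminus Y$, $a\le b$ and $a\alpha\ge b\alpha$. $\mathcal{OP}(X)$ is the monoid, under composition, of all orientation-preserving full transformations of $X$. $\ker(\alpha)=\{(x,y)\in X\times X\mid x\alpha=y\alpha\}$. Green's relations on a monoid $S$: $\alpha\,\mathcal{L}\,\beta$ iff $S\alpha=S\beta$; $\alpha\,\mathcal{R}\,\beta$ iff $\alpha S=\beta S$; $\mathcal{H}=\mathcal{L}\cap\mathcal{R}$. If $\ker(\alpha)=\ker(\beta)$, the canonical bijection $\phi:\mathrm{Im}(\alpha)\to\mathrm{Im}(\beta)$ is defined by: $a\phi=b$ iff $a\alpha^{-1}=b\beta^{-1}$ (equality of preimage sets), for $a\in\mathrm{Im}(\alpha)$,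 $b\in\mathrm{Im}(\beta)$; equivalently $a\phi=x\beta$ for any $x\in a\alpha^{-1}$. For $A,B\subseteq X$, a mapping $\theta:A\to B$ is completable in $\mathcal{OP}(X)$ if there exists $\gamma\in\mathcal{OP}(X)$ with $x\gamma=x\theta$ for all $x\in A$. A bijection $\theta:A\to B$ is bicompletable in $\mathcal{OP}(X)$ if both $\theta$ and its inverse $\theta^{-1}:B\to A$ are completable in $\mathcal{OP}(X)$. *)

theory Defs
  imports Main "HOL-Library.FuncSet" "HOL-Algebra.Group"
begin

text \<open>
  The chain is an arbitrary, possibly empty, subset \<open>X\<close> of a linearly ordered type. A full
  transformation of \<open>X\<close> is an element of \<open>X \<rightarrow>\<^sub>E X\<close>, so that two transformations
  are equal exactly when they agree on \<open>X\<close>.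
\<close>

definition orientation_preserving :: "'a::linorder set \<Rightarrow> ('a \<Rightarrow> 'a) \<Rightarrow> bool" where
  "orientation_preserving X \<alpha> \<longleftrightarrow>
     X = {} \<or>
     (\<exists>Y. Y \<noteq> {} \<and> Y \<subseteq> X \<and>
        mono_on Y \<alpha> \<and> mono_on (X - Y) \<alpha> \<and>
        (\<forall>a\<in>Y. \<forall>b\<in>X - Y. a \<le> b \<and> \<alpha> a \<ge> \<alpha> b))"

text \<open>
  Maps are composed from left to right: the product \<open>\<alpha> \<beta>\<close> applies \<open>\<alpha>\<close> first.
\<close>

definition OP :: "'a::linorder set \<Rightarrow> ('a \<Rightarrow> 'a) monoid" where
  "OP X = \<lparr>carrier = {\<alpha> \<in> X \<rightarrow>\<^sub>E X. orientation_preserving X \<alpha>},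
           mult = (\<lambda>\<alpha> \<beta>. compose X \<beta> \<alpha>),
           one = (\<lambda>x\<in>X. x)\<rparr>"

definition green_L :: "('a, 'b) monoid_scheme \<Rightarrow> ('a \<times> 'a) set" where
  "green_L S = {(a, b). a \<in> carrier S \<and> b \<in> carrier S \<and>
     (\<lambda>s. s \<otimes>\<^bsub>S\<^esub> a) ` carrier S = (\<lambda>s. s \<otimes>\<^bsub>S\<^esub> b) ` carrier S}"

definition green_R :: "('a, 'b) monoid_scheme \<Rightarrow> ('a \<times> 'a) set" where
  "green_R S = {(a, b). a \<in> carrier S \<and> b \<in> carrier S \<and>
     (\<lambda>s. a \<otimes>\<^bsub>S\<^esub> s) ` carrier S = (\<lambda>s. b \<otimes>\<^bsub>S\<^esub> s) ` carrier S}"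

definition green_H :: "('a, 'b) monoid_scheme \<Rightarrow> ('a \<times> 'a) set" where
  "green_H S = green_L S \<inter> green_R S"

definition trans_ker :: "'a set \<Rightarrow> ('a \<Rightarrow> 'a) \<Rightarrow> ('a \<times> 'a) set" where
  "trans_ker X \<alpha> = {(x, y) \<in> X \<times> X. \<alpha> x = \<alpha> y}"

text \<open>
  The canonical bijection from \<open>\<alpha> ` X\<close> onto \<open>\<beta> ` X\<close>; the description is
  well defined when \<open>\<alpha>\<close> and \<open>\<beta>\<close> have the same kernel, and carries no meaning otherwise.
\<close>

definition canonical_bij :: "'a set \<Rightarrow> ('a \<Rightarrow> 'a) \<Rightarrow> ('a \<Rightarrow> 'a) \<Rightarrow> 'a \<Rightarrow> 'a" where
  "canonical_bij X \<alpha> \<beta> =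
     (\<lambda>a\<in>\<alpha> ` X. THE b. b \<in> \<beta> ` X \<and> {x \<in> X. \<alpha> x = a} = {x \<in> X. \<beta> x = b})"

definition completable ::
  "'a::linorder set \<Rightarrow> 'a set \<Rightarrow> 'a set \<Rightarrow> ('a \<Rightarrow> 'a) \<Rightarrow> bool" where
  "completable X A B \<theta> \<longleftrightarrow>
     A \<subseteq> X \<and> B \<subseteq> X \<and> \<theta> \<in> A \<rightarrow> B \<and> (\<exists>\<gamma>\<in>carrier (OP X). \<forall>x\<in>A. \<gamma> x = \<theta> x)"

definition bicompletable ::
  "'a::linorder set \<Rightarrow> 'a set \<Rightarrow> 'a set \<Rightarrow> ('a \<Rightarrow> 'a) \<Rightarrow> bool" where
  "bicompletable X A B \<theta> \<longleftrightarrow>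
     bij_betw \<theta> A B \<and> completable X A B \<theta> \<and> completable X B A (inv_into A \<theta>)"

end

theory Submission imports Defs begin

text \<open>
  In any monoid, \<open>\<alpha> \<R> \<beta>\<close> says that each of the two elements is a right multiple of the other, and
  \<open>\<alpha> \<L> \<beta>\<close> says the same with left multiples; the two conditions decouple.

  For \<open>\<R>\<close>: if \<open>\<beta> = \<alpha> \<gamma>\<close> and \<open>\<alpha> = \<beta> \<delta>\<close>, then the kernels agree, and the value of \<open>\<gamma>\<close> at
  \<open>x \<alpha>\<close> is \<open>x \<beta>\<close>, so that \<open>\<gamma>\<close> extends the canonical bijection and \<open>\<delta>\<close> extends its inverse.
  Conversely, any such extensions are multipliers of the required kind. Hence \<open>\<R>\<close> amounts to
  equality of kernels and bicompletability of the canonical bijection (lemma \<open>green_R_OP_iff\<close>).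

  For \<open>\<L>\<close>: a left multiple of \<open>\<alpha>\<close> has an image inside that of \<open>\<alpha>\<close>. The point is the converse, that
  images alone decide \<open>\<L>\<close> (lemma \<open>green_L_OP_iff\<close>). Here one needs an orientation-preserving
  \<open>\<gamma>\<close> with \<open>\<beta> = \<gamma> \<alpha>\<close>, and \<open>\<gamma>\<close> can be taken to be \<open>\<beta>\<close> followed by a section of \<open>\<alpha>\<close>. An arbitrary
  section would not do, but \<open>\<alpha>\<close> sends its lower part \<open>Y\<close> above its upper part \<open>X - Y\<close>, and both
  parts monotonically; picking preimages consistently from \<open>X - Y\<close> whenever possible yields
  a section that again exchanges a lower and an upper part of its domain
  (lemma \<open>orientation_preserving_section\<close>).

  Everything rests on the fact that orientation-preserving maps compose
  (lemma \<open>orientation_preserving_comp\<close>). It is needed for a map defined only on the image of the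
  other one, since sections are not defined on the whole chain.
\<close>

section \<open>Orientation-preserving maps\<close>

text \<open>
  Admitting the empty set as a lower part changes nothing, because it then says that the map is
  monotone on all of \<open>X\<close>, for which \<open>X\<close> itself serves as a lower part. This removes the case
  distinctions on emptiness, both of \<open>X\<close> and of the lower part.
\<close>

lemma orientation_preserving_iff:
  "orientation_preserving X f \<longleftrightarrow>
     (\<exists>Y\<subseteq>X. mono_on Y f \<and> mono_on (X - Y) f \<and> (\<forall>a\<in>Y. \<forall>b\<in>X - Y. a \<le> b \<and> f b \<le> f a))"
  (is "_ \<longleftrightarrow> (\<exists>Y\<subseteq>X. ?P Y)")
proof
  assume "orientation_preserving X f"
  moreover have "?P {}" if "X = {}"
    using that by (simp add: mono_on_def)
  ultimately show "\<exists>Y\<subseteq>X. ?P Y"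
    unfolding orientation_preserving_def by blast
next
  assume "\<exists>Y\<subseteq>X. ?P Y"
  then obtain Y where Y: "Y \<subseteq> X" "?P Y" by blast
  show "orientation_preserving X f"
  proof (cases "Y = {}")
    case True
    with Y have "?P X" by (simp add: mono_on_def)
    then show ?thesis unfolding orientation_preserving_def by blast
  next
    case False
    with Y show ?thesis unfolding orientation_preserving_def by blast
  qed
qed

lemma orientation_preserving_cong:
  assumes "\<And>x. x \<in> X \<Longrightarrow> f x = g x"
  shows "orientation_preserving X f \<longleftrightarrow> orientation_preserving X g"
proof -
  have "mono_on Y f \<longleftrightarrow> mono_on Y g" if "Y \<subseteq> X" for Y
    using that assms by (simp add: mono_on_def subset_iff)
  moreover have "(\<forall>a\<in>Y. \<forall>b\<in>X - Y. a \<le> b \<and> f b \<le> f a) \<longleftrightarrow>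
      (\<forall>a\<in>Y. \<forall>b\<in>X - Y. a \<le> b \<and> g b \<le> g a)" if "Y \<subseteq> X" for Y
    by (intro ball_cong refl) (use assms that in \<open>simp add: subset_iff\<close>)
  ultimately show ?thesis
    unfolding orientation_preserving_iff by (intro ex_cong1 conj_cong refl) simp_all
qed

lemma orientation_preserving_subset:
  assumes "orientation_preserving X f" and "Z \<subseteq> X"
  shows "orientation_preserving Z f"
proof -
  obtain Y where Y: "Y \<subseteq> X" "mono_on Y f" "mono_on (X - Y) f"
      "\<And>a b. a \<in> Y \<Longrightarrow> b \<in> X - Y \<Longrightarrow> a \<le> b \<and> f b \<le> f a"
    using assms(1) unfolding orientation_preserving_iff by blast
  show ?thesis
    unfolding orientation_preserving_iff
  proof (intro exI[of _ "Z \<inter> Y"] conjI)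
    show "mono_on (Z \<inter> Y) f" by (rule mono_on_subset[OF Y(2)]) simp
    show "mono_on (Z - Z \<inter> Y) f" by (rule mono_on_subset[OF Y(3)]) (use assms(2) in blast)
    show "\<forall>a\<in>Z \<inter> Y. \<forall>b\<in>Z - Z \<inter> Y. a \<le> b \<and> f b \<le> f a"
      using Y(4) assms(2) by blast
  qed simp
qed

text \<open>
  Let \<open>Y\<close> and \<open>Z\<close> be lower parts for \<open>f\<close> and \<open>g\<close>. They cut \<open>X\<close> into four successive blocks,
  according to membership of \<open>x\<close> in \<open>Y\<close> and of \<open>f x\<close> in \<open>Z\<close>, and the composite is monotone on
  each of them. From the second block to the third, \<open>f\<close> drops because \<open>Y\<close> is left, which brings its
  values back into \<open>Z\<close>, so that \<open>g\<close> rises. The composite can thus drop only after the first block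
  and before the last one. These two do not coexist, because \<open>f\<close> maps \<open>Y\<close> above \<open>X - Y\<close>:
  were both blocks inhabited, a value in \<open>Z\<close> would lie above one outside \<open>Z\<close>.
  In the proof, \<open>P\<close> is the first block and \<open>S\<close> the last.
\<close>

lemma orientation_preserving_comp:
  assumes "orientation_preserving X f" and "orientation_preserving (f ` X) g"
  shows "orientation_preserving X (g \<circ> f)"
proof -
  obtain Y where Y: "Y \<subseteq> X" "mono_on Y f" "mono_on (X - Y) f"
      "\<And>a b. a \<in> Y \<Longrightarrow> b \<in> X - Y \<Longrightarrow> a \<le> b \<and> f b \<le> f a"
    using assms(1) unfolding orientation_preserving_iff by blast
  obtain Z where Z: "mono_on Z g" "mono_on (f ` X - Z) g"
      "\<And>a b. a \<in> Z \<Longrightarrow> b \<in> f ` X - Z \<Longrightarrow> a \<le> b \<and> g b \<le> g a"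
    using assms(2) unfolding orientation_preserving_iff by blast
  define P where "P = {x \<in> Y. f x \<in> Z}"
  define S where "S = {x \<in> X - Y. f x \<notin> Z}"
  have f_mono: "f x \<le> f y" if "x \<le> y" "x \<in> X" "y \<in> X" "x \<in> Y \<longleftrightarrow> y \<in> Y" for x y
    using that Y(2,3) by (auto simp: mono_on_def)
  have g_mono: "g (f x) \<le> g (f y)" if "f x \<le> f y" "x \<in> X" "y \<in> X" "f x \<in> Z \<longleftrightarrow> f y \<in> Z" for x y
    using that Z(1,2) by (auto simp: mono_on_def)
  have Y_less: "x \<in> Y" if "x \<le> y" "x \<in> X" "y \<in> Y" for x y
    using that Y(4)[of y x] by (cases "x = y") auto
  have Z_less: "f x \<in> Z" if "f x \<le> f y" "x \<in> X" "f y \<in> Z" for x y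
    using that Z(3)[of "f y" "f x"] by (cases "f x = f y") auto
  have across_Z: "g (f y) \<le> g (f x)" if "y \<in> X" "f x \<in> Z" "f y \<notin> Z" for x y
    using that Z(3) by blast
  have middle: "g (f x) \<le> g (f y)" if "x \<le> y" "x \<in> X - P - S" "y \<in> X - P - S" for x y
  proof (cases "x \<in> Y \<longleftrightarrow> y \<in> Y")
    case True
    with that show ?thesis by (auto simp: P_def S_def intro!: g_mono f_mono)
  next
    case False
    with that Y_less have "x \<in> Y" "y \<notin> Y" by auto
    with that show ?thesis by (auto simp: P_def S_def intro!: across_Z)
  qed
  show ?thesis
  proof (cases "S = {}")
    case True
    show ?thesis
      unfolding orientation_preserving_iff
    proof (intro exI[of _ P] conjI ballI)
      show "P \<subseteq> X" using Y(1) by (auto simp: P_def)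
      show "mono_on P (g \<circ> f)"
        using Y(1) by (auto simp: mono_on_def P_def intro!: g_mono f_mono)
      show "mono_on (X - P) (g \<circ> f)"
        using middle True by (auto simp: mono_on_def)
      fix a b assume a: "a \<in> P" and b: "b \<in> X - P"
      show "a \<le> b"
      proof (cases "b \<in> Y")
        case True
        then have "f b \<notin> Z" using b by (simp add: P_def)
        then show ?thesis
          using a b True Y(1) Z_less[of b a] f_mono[of b a] linear[of a b] by (auto simp: P_def)
      next
        case False
        then show ?thesis using a b Y(4) by (simp add: P_def)
      qed
      show "(g \<circ> f) b \<le> (g \<circ> f) a"
      proof (cases "f b \<in> Z")
        case in_Z: True
        then have "b \<notin> Y" using b by (simp add: P_def)
        then show ?thesis using a b in_Z Y(1,4) by (auto simp: P_def intro!: g_mono)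
      next
        case False
        then show ?thesis using a b across_Z by (simp add: P_def)
      qed
    qed
  next
    case False
    have "P = {}"
    proof (rule ccontr)
      assume "P \<noteq> {}"
      with False obtain p s where ps: "p \<in> Y" "f p \<in> Z" "s \<in> X - Y" "f s \<notin> Z"
        by (auto simp: P_def S_def)
      then show False using Y(4)[of p s] Z_less[of s p] by auto
    qed
    show ?thesis
      unfolding orientation_preserving_iff
    proof (intro exI[of _ "X - S"] conjI ballI)
      show "mono_on (X - S) (g \<circ> f)"
        using middle \<open>P = {}\<close> by (auto simp: mono_on_def)
      show "mono_on (X - (X - S)) (g \<circ> f)"
        by (auto simp: mono_on_def S_def intro!: g_mono f_mono)
      fix a b assume a: "a \<in> X - S" and b: "b \<in> X - (X - S)"
      then have b': "b \<in> X" "b \<notin> Y" "f b \<notin> Z" by (auto simp: S_def)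
      show "a \<le> b"
      proof (cases "a \<in> Y")
        case True
        then show ?thesis using b' Y(4) by blast
      next
        case False
        then have "f a \<in> Z" using a by (simp add: S_def)
        then show ?thesis
          using a b' False Z_less[of b a] f_mono[of b a] linear[of a b] by auto
      qed
      show "(g \<circ> f) b \<le> (g \<circ> f) a"
      proof (cases "f a \<in> Z")
        case True
        then show ?thesis using b' across_Z by simp
      next
        case False
        then have "a \<in> Y" using a by (simp add: S_def)
        then show ?thesis using a b' False Y(4) by (auto intro!: g_mono)
      qed
    qed simp
  qed
qed

text \<open>
  With \<open>Y\<close> a lower part for \<open>f\<close>, the image splits into \<open>f ` (X - Y)\<close>, which lies below, and
  the rest, which lies above. Preimages taken in \<open>X - Y\<close> for the former and in \<open>Y\<close> for the latter
  depend monotonically on the point within each piece, and the two pieces trade places. The overlap of \<open>f ` Y\<close> and \<open>f ` (X - Y)\<close>, at most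
  one point, has to be assigned to one side, here to the lower one.
\<close>

lemma orientation_preserving_section:
  assumes "orientation_preserving X f"
  obtains s where "orientation_preserving (f ` X) s"
    and "\<And>i. i \<in> f ` X \<Longrightarrow> s i \<in> X \<and> f (s i) = i"
proof -
  obtain Y where Y: "Y \<subseteq> X" "mono_on Y f" "mono_on (X - Y) f"
      "\<And>a b. a \<in> Y \<Longrightarrow> b \<in> X - Y \<Longrightarrow> a \<le> b \<and> f b \<le> f a"
    using assms unfolding orientation_preserving_iff by blast
  define I where "I = f ` (X - Y)"
  define s where "s i = (if i \<in> I then inv_into (X - Y) f i else inv_into Y f i)" for i
  have low: "s i \<in> X - Y" "f (s i) = i" if "i \<in> I" for i
    using that inv_into_into[of i f "X - Y"] f_inv_into_f[of i f "X - Y"]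
    by (simp_all add: s_def I_def)
  have high: "s i \<in> Y" "f (s i) = i" if "i \<in> f ` X - I" for i
  proof -
    have "i \<in> f ` Y" using that by (auto simp: I_def)
    then show "s i \<in> Y" "f (s i) = i"
      using that by (simp_all add: s_def inv_into_into f_inv_into_f)
  qed
  \<comment> \<open>A right inverse of a monotone map into a chain is monotone.\<close>
  have mono_section: "mono_on J s"
    if "mono_on W f" and "\<And>i. i \<in> J \<Longrightarrow> s i \<in> W \<and> f (s i) = i" for J W
  proof (rule mono_onI, rule ccontr)
    fix i j assume "i \<in> J" "j \<in> J" "i \<le> j" "\<not> s i \<le> s j"
    then have "f (s j) \<le> f (s i)"
      using that(2) by (intro mono_onD[OF that(1)]) auto
    then have "j \<le> i" using that(2)[OF \<open>i \<in> J\<close>] that(2)[OF \<open>j \<in> J\<close>] by simp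
    with \<open>i \<le> j\<close> have "i = j" by (rule order.antisym)
    with \<open>\<not> s i \<le> s j\<close> show False by simp
  qed
  have "orientation_preserving (f ` X) s"
    unfolding orientation_preserving_iff
  proof (intro exI[of _ I] conjI ballI)
    show "I \<subseteq> f ` X" by (auto simp: I_def)
    show "mono_on I s" using mono_section[OF Y(3)] low by blast
    show "mono_on (f ` X - I) s" using mono_section[OF Y(2)] high by blast
    fix a b assume ab: "a \<in> I" "b \<in> f ` X - I"
    from Y(4)[OF high(1)[OF ab(2)] low(1)[OF ab(1)]]
    show "a \<le> b" "s b \<le> s a" using low(2)[OF ab(1)] high(2)[OF ab(2)] by auto
  qed
  moreover have "s i \<in> X \<and> f (s i) = i" if "i \<in> f ` X" for i
    using that low high Y(1) by (cases "i \<in> I") auto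
  ultimately show thesis by (rule that)
qed

section \<open>The monoid of orientation-preserving transformations\<close>

lemma OP_carrier_iff: "f \<in> carrier (OP X) \<longleftrightarrow> f \<in> X \<rightarrow>\<^sub>E X \<and> orientation_preserving X f"
  by (simp add: OP_def)

lemma OP_closed: "f \<in> carrier (OP X) \<Longrightarrow> x \<in> X \<Longrightarrow> f x \<in> X"
  by (auto simp: OP_carrier_iff)

lemma OP_mult: "f \<otimes>\<^bsub>OP X\<^esub> g = compose X g f"
  by (simp add: OP_def)

lemma OP_eq_mult_iff:
  assumes "f \<in> carrier (OP X)"
  shows "f = g \<otimes>\<^bsub>OP X\<^esub> h \<longleftrightarrow> (\<forall>x\<in>X. f x = h (g x))"
  using assms by (auto simp: OP_mult OP_carrier_iff compose_def PiE_def extensional_def)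

lemma OP_restrict_comp:
  assumes "orientation_preserving X f" and "orientation_preserving (f ` X) g" and "g ` f ` X \<subseteq> X"
  shows "restrict (g \<circ> f) X \<in> carrier (OP X)"
proof -
  have "orientation_preserving X (restrict (g \<circ> f) X) \<longleftrightarrow> orientation_preserving X (g \<circ> f)"
    by (rule orientation_preserving_cong) simp
  then show ?thesis
    using assms orientation_preserving_comp by (auto simp: OP_carrier_iff)
qed

lemma monoid_OP: "monoid (OP X)"
proof (rule monoidI)
  show "\<one>\<^bsub>OP X\<^esub> \<in> carrier (OP X)"
    by (auto simp: OP_def orientation_preserving_iff mono_on_def intro!: exI[of _ X])
next
  fix f g assume fg: "f \<in> carrier (OP X)" "g \<in> carrier (OP X)"
  have "compose X g f = restrict (g \<circ> f) X" by (simp add: compose_def comp_def)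
  moreover have "f ` X \<subseteq> X" using fg OP_closed by blast
  moreover have "g ` f ` X \<subseteq> X" using fg OP_closed by blast
  ultimately show "f \<otimes>\<^bsub>OP X\<^esub> g \<in> carrier (OP X)"
    using OP_restrict_comp[of X f g] orientation_preserving_subset[of X g "f ` X"] fg
    by (simp only: OP_mult OP_carrier_iff)
next
  fix f g h assume "f \<in> carrier (OP X)"
  then show "f \<otimes>\<^bsub>OP X\<^esub> g \<otimes>\<^bsub>OP X\<^esub> h = f \<otimes>\<^bsub>OP X\<^esub> (g \<otimes>\<^bsub>OP X\<^esub> h)"
    by (auto simp: OP_mult compose_def OP_closed)
next
  fix f assume f: "f \<in> carrier (OP X)"
  then show "\<one>\<^bsub>OP X\<^esub> \<otimes>\<^bsub>OP X\<^esub> f = f" "f \<otimes>\<^bsub>OP X\<^esub> \<one>\<^bsub>OP X\<^esub> = f"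
    by (auto simp: OP_def compose_def PiE_def extensional_def fun_eq_iff)
qed

section \<open>Green's relations\<close>

lemma (in monoid) green_L_iff:
  assumes "a \<in> carrier G" and "b \<in> carrier G"
  shows "(a, b) \<in> green_L G \<longleftrightarrow> (\<exists>s\<in>carrier G. a = s \<otimes> b) \<and> (\<exists>s\<in>carrier G. b = s \<otimes> a)"
proof -
  have "(\<lambda>s. s \<otimes> a) ` carrier G \<subseteq> (\<lambda>s. s \<otimes> b) ` carrier G \<longleftrightarrow> (\<exists>s\<in>carrier G. a = s \<otimes> b)"
    if ab: "a \<in> carrier G" "b \<in> carrier G" for a b
  proof
    assume "(\<lambda>s. s \<otimes> a) ` carrier G \<subseteq> (\<lambda>s. s \<otimes> b) ` carrier G"
    moreover have "a \<in> (\<lambda>s. s \<otimes> a) ` carrier G" by (rule image_eqI[of _ _ \<one>]) (use ab in auto)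
    ultimately show "\<exists>s\<in>carrier G. a = s \<otimes> b" by blast
  next
    assume "\<exists>s\<in>carrier G. a = s \<otimes> b"
    then obtain s where s: "s \<in> carrier G" "a = s \<otimes> b" by blast
    show "(\<lambda>s. s \<otimes> a) ` carrier G \<subseteq> (\<lambda>s. s \<otimes> b) ` carrier G"
    proof (rule image_subsetI)
      fix t assume "t \<in> carrier G"
      with s ab have "t \<otimes> a = (t \<otimes> s) \<otimes> b" "t \<otimes> s \<in> carrier G" by (simp_all add: m_assoc)
      then show "t \<otimes> a \<in> (\<lambda>s. s \<otimes> b) ` carrier G" by blast
    qed
  qed
  with assms show ?thesis by (simp add: green_L_def set_eq_subset)
qed

lemma (in monoid) green_R_iff:
  assumes "a \<in> carrier G" and "b \<in> carrier G"
  shows "(a, b) \<in> green_R G \<longleftrightarrow> (\<exists>s\<in>carrier G. a = b \<otimes> s) \<and> (\<exists>s\<in>carrier G. b = a \<otimes> s)"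
proof -
  have "(\<lambda>s. a \<otimes> s) ` carrier G \<subseteq> (\<lambda>s. b \<otimes> s) ` carrier G \<longleftrightarrow> (\<exists>s\<in>carrier G. a = b \<otimes> s)"
    if ab: "a \<in> carrier G" "b \<in> carrier G" for a b
  proof
    assume "(\<lambda>s. a \<otimes> s) ` carrier G \<subseteq> (\<lambda>s. b \<otimes> s) ` carrier G"
    moreover have "a \<in> (\<lambda>s. a \<otimes> s) ` carrier G" by (rule image_eqI[of _ _ \<one>]) (use ab in auto)
    ultimately show "\<exists>s\<in>carrier G. a = b \<otimes> s" by blast
  next
    assume "\<exists>s\<in>carrier G. a = b \<otimes> s"
    then obtain s where s: "s \<in> carrier G" "a = b \<otimes> s" by blast
    show "(\<lambda>s. a \<otimes> s) ` carrier G \<subseteq> (\<lambda>s. b \<otimes> s) ` carrier G"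
    proof (rule image_subsetI)
      fix t assume "t \<in> carrier G"
      with s ab have "a \<otimes> t = b \<otimes> (s \<otimes> t)" "s \<otimes> t \<in> carrier G" by (simp_all add: m_assoc)
      then show "a \<otimes> t \<in> (\<lambda>s. b \<otimes> s) ` carrier G" by blast
    qed
  qed
  with assms show ?thesis by (simp add: green_R_def set_eq_subset)
qed

text \<open>
  For the converse, the multiplier is \<open>g\<close> followed by an orientation-preserving section of \<open>f\<close>, which is defined
  wherever \<open>g\<close> takes a value.
\<close>

lemma OP_left_multiple_iff:
  assumes f: "f \<in> carrier (OP X)" and g: "g \<in> carrier (OP X)"
  shows "(\<exists>s\<in>carrier (OP X). g = s \<otimes>\<^bsub>OP X\<^esub> f) \<longleftrightarrow> g ` X \<subseteq> f ` X"
proof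
  assume "\<exists>s\<in>carrier (OP X). g = s \<otimes>\<^bsub>OP X\<^esub> f"
  then obtain s where "s \<in> carrier (OP X)" "\<forall>x\<in>X. g x = f (s x)"
    using OP_eq_mult_iff[OF g] by blast
  then show "g ` X \<subseteq> f ` X" using OP_closed by fastforce
next
  assume sub: "g ` X \<subseteq> f ` X"
  have of: "orientation_preserving X f" and og: "orientation_preserving X g"
    using f g by (simp_all add: OP_carrier_iff)
  obtain s where s: "orientation_preserving (f ` X) s"
      "\<And>i. i \<in> f ` X \<Longrightarrow> s i \<in> X \<and> f (s i) = i"
    using orientation_preserving_section[OF of] by blast
  have "restrict (s \<circ> g) X \<in> carrier (OP X)"
    using orientation_preserving_subset[OF s(1) sub] s(2) sub
    by (intro OP_restrict_comp[OF og]) auto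
  moreover have "g = restrict (s \<circ> g) X \<otimes>\<^bsub>OP X\<^esub> f"
    using s(2) sub by (auto simp: OP_eq_mult_iff[OF g] image_subset_iff)
  ultimately show "\<exists>s\<in>carrier (OP X). g = s \<otimes>\<^bsub>OP X\<^esub> f" by blast
qed

lemma green_L_OP_iff:
  assumes "f \<in> carrier (OP X)" and "g \<in> carrier (OP X)"
  shows "(f, g) \<in> green_L (OP X) \<longleftrightarrow> f ` X = g ` X"
  using assms by (auto simp: monoid.green_L_iff[OF monoid_OP] OP_left_multiple_iff)

lemma trans_ker_eq_iff:
  "trans_ker X f = trans_ker X g \<longleftrightarrow> (\<forall>x\<in>X. \<forall>y\<in>X. f x = f y \<longleftrightarrow> g x = g y)"
  by (auto simp: trans_ker_def set_eq_iff)

lemma canonical_bij_apply: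
  assumes "trans_ker X f = trans_ker X g" and "x \<in> X"
  shows "canonical_bij X f g (f x) = g x"
proof -
  have "(THE b. b \<in> g ` X \<and> {y \<in> X. f y = f x} = {y \<in> X. g y = b}) = g x"
    using assms by (intro the_equality) (auto simp: trans_ker_eq_iff)
  with assms(2) show ?thesis by (simp add: canonical_bij_def)
qed

lemma bij_betw_canonical_bij:
  assumes "trans_ker X f = trans_ker X g"
  shows "bij_betw (canonical_bij X f g) (f ` X) (g ` X)"
  using assms canonical_bij_apply[OF assms]
  by (auto simp: bij_betw_def inj_on_def image_image trans_ker_eq_iff)

lemma inv_into_canonical_bij_apply:
  assumes "trans_ker X f = trans_ker X g" and "x \<in> X"
  shows "inv_into (f ` X) (canonical_bij X f g) (g x) = f x"
proof (rule inv_into_f_eq)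
  show "inj_on (canonical_bij X f g) (f ` X)"
    using bij_betw_canonical_bij[OF assms(1)] by (simp add: bij_betw_def)
qed (use assms canonical_bij_apply in auto)

text \<open>
  The completions of \<open>\<phi>\<close> and \<open>\<phi>\<^sup>-\<^sup>1\<close>, for \<open>\<phi>\<close> the canonical bijection, are exactly the right
  multipliers that carry \<open>f\<close> to \<open>g\<close> and \<open>g\<close> to \<open>f\<close>.
\<close>

lemma bicompletable_canonical_bij_iff:
  assumes f: "f \<in> carrier (OP X)" and g: "g \<in> carrier (OP X)"
    and ker: "trans_ker X f = trans_ker X g"
  shows "bicompletable X (f ` X) (g ` X) (canonical_bij X f g) \<longleftrightarrow>
    (\<exists>s\<in>carrier (OP X). f = g \<otimes>\<^bsub>OP X\<^esub> s) \<and> (\<exists>s\<in>carrier (OP X). g = f \<otimes>\<^bsub>OP X\<^esub> s)"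
proof -
  have sub: "f ` X \<subseteq> X" "g ` X \<subseteq> X" using f g OP_closed by blast+
  have "completable X (f ` X) (g ` X) (canonical_bij X f g) \<longleftrightarrow>
      (\<exists>s\<in>carrier (OP X). g = f \<otimes>\<^bsub>OP X\<^esub> s)"
    using sub canonical_bij_apply[OF ker]
    by (auto simp: completable_def OP_eq_mult_iff[OF g] eq_commute[of "g _"])
  moreover have "completable X (g ` X) (f ` X) (inv_into (f ` X) (canonical_bij X f g)) \<longleftrightarrow>
      (\<exists>s\<in>carrier (OP X). f = g \<otimes>\<^bsub>OP X\<^esub> s)"
    using sub inv_into_canonical_bij_apply[OF ker]
    by (auto simp: completable_def OP_eq_mult_iff[OF f] eq_commute[of "f _"])
  ultimately show ?thesis
    using bij_betw_canonical_bij[OF ker] unfolding bicompletable_def by blast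
qed

lemma green_R_OP_iff:
  assumes f: "f \<in> carrier (OP X)" and g: "g \<in> carrier (OP X)"
  shows "(f, g) \<in> green_R (OP X) \<longleftrightarrow>
    trans_ker X f = trans_ker X g \<and> bicompletable X (f ` X) (g ` X) (canonical_bij X f g)"
proof -
  have "trans_ker X f = trans_ker X g"
    if mult: "\<exists>s\<in>carrier (OP X). f = g \<otimes>\<^bsub>OP X\<^esub> s"
      "\<exists>s\<in>carrier (OP X). g = f \<otimes>\<^bsub>OP X\<^esub> s"
  proof -
    obtain s t where "\<forall>x\<in>X. f x = s (g x)" "\<forall>x\<in>X. g x = t (f x)"
      using mult unfolding OP_eq_mult_iff[OF f] OP_eq_mult_iff[OF g] by blast
    then show ?thesis unfolding trans_ker_eq_iff by metis
  qed
  then show ?thesis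
    using bicompletable_canonical_bij_iff[OF f g] monoid.green_R_iff[OF monoid_OP f g] by blast
qed

theorem corollary4p6:
  fixes X :: "'a::linorder set" and \<alpha> \<beta> :: "'a \<Rightarrow> 'a"
  assumes "\<alpha> \<in> carrier (OP X)" and "\<beta> \<in> carrier (OP X)"
  shows "(\<alpha>, \<beta>) \<in> green_H (OP X) \<longleftrightarrow>
    \<alpha> ` X = \<beta> ` X \<and>
    trans_ker X \<alpha> = trans_ker X \<beta> \<and>
    bicompletable X (\<alpha> ` X) (\<beta> ` X) (canonical_bij X \<alpha> \<beta>)"
  using green_L_OP_iff[OF assms] green_R_OP_iff[OF assms] by (simp add: green_H_def)

end
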